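(* Let $q=\dfrac{a^4+b^4+c^4}{(a^2+b^2+c^2)^2}$ be the quadrofactor of a plane triangle with side lengths $a,b,c$. Then 1. $\frac13\le q\le\frac12$; 2. $q=\frac13$ if and only if the triangle is regular; 3. $q=\frac12$ if and only if the triangle is linear.
   Context: A plane triangle is a triple $(z_1,z_2,z_3)$ of points of $\mathbb C$ that is non-singular, i.e. not $z_1=z_2=z_3$; its sides are $a=|z_1-z_2|$, $b=|z_2-z_3|$, $c=|z_3-z_1|$. A triangle is equilateral if $a=b=c$; regular if it is equilateral and not singular; linear if there are pairwise distinct $i,j,k\in\{1,2,3\}$ with $|z_i-z_k|=|z_i-z_j|+|z_j-z_k|$. *)

theory Defs
  imports "HOL-Analysis.Analysis"
begin

(* A triple of points is a vector z :: complex^3.  The three elements of the index type 3 are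
   1, 2 and 3 (see UNIV_3), so quantifying over this type is quantifying over {1,2,3}. *)

definition singular :: "complex ^ 3 \<Rightarrow> bool" where
  "singular z \<longleftrightarrow> z $ 1 = z $ 2 \<and> z $ 2 = z $ 3"

definition plane_triangle :: "complex ^ 3 \<Rightarrow> bool" where
  "plane_triangle z \<longleftrightarrow> \<not> singular z"

definition side_a :: "complex ^ 3 \<Rightarrow> real" where
  "side_a z = norm (z $ 1 - z $ 2)"

definition side_b :: "complex ^ 3 \<Rightarrow> real" where
  "side_b z = norm (z $ 2 - z $ 3)"

definition side_c :: "complex ^ 3 \<Rightarrow> real" where
  "side_c z = norm (z $ 3 - z $ 1)"

definition equilateral :: "complex ^ 3 \<Rightarrow> bool" where
  "equilateral z \<longleftrightarrow> side_a z = side_b z \<and> side_b z = side_c z"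

definition regular :: "complex ^ 3 \<Rightarrow> bool" where
  "regular z \<longleftrightarrow> equilateral z \<and> \<not> singular z"

(* Only the indices must be distinct; two vertices may coincide. *)
definition linear_triangle :: "complex ^ 3 \<Rightarrow> bool" where
  "linear_triangle z \<longleftrightarrow>
     (\<exists>i j k :: 3. i \<noteq> j \<and> j \<noteq> k \<and> i \<noteq> k \<and>
        norm (z $ i - z $ k) = norm (z $ i - z $ j) + norm (z $ j - z $ k))"

(* The denominator is nonzero for every plane triangle. *)
definition quadrofactor :: "complex ^ 3 \<Rightarrow> real" where
  "quadrofactor z =
     (side_a z ^ 4 + side_b z ^ 4 + side_c z ^ 4) /
     (side_a z ^ 2 + side_b z ^ 2 + side_c z ^ 2) ^ 2"

end

theory Submission
  imports Defs
begin

text \<open>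
  Both bounds come from polynomial identities in the side lengths. Clearing denominators,
  the excess of \<open>q\<close> over \<open>1/3\<close> is a sum of squares of differences of the squared sides, so it is
  nonnegative and vanishes exactly when all sides agree. The deficit of \<open>q\<close> from \<open>1/2\<close> is Heron's
  product (sixteen times the squared area): its factors are nonnegative by the triangle
  inequality, and since the perimeter of a non-singular triangle is positive, the product vanishes
  exactly when one of the triangle inequalities is an equality, i.e. when the triangle is linear.
\<close>

lemma square_sum_sub_double_quartic_eq_heron:
  fixes a b c :: real
  shows "(a\<^sup>2 + b\<^sup>2 + c\<^sup>2)\<^sup>2 - 2 * (a ^ 4 + b ^ 4 + c ^ 4)
    = (a + b + c) * (a + b - c) * (b + c - a) * (c + a - b)"
  by algebra

lemma triple_quartic_sub_square_sum:
  fixes a b c :: real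
  shows "3 * (a ^ 4 + b ^ 4 + c ^ 4) - (a\<^sup>2 + b\<^sup>2 + c\<^sup>2)\<^sup>2
    = (a\<^sup>2 - b\<^sup>2)\<^sup>2 + (b\<^sup>2 - c\<^sup>2)\<^sup>2 + (c\<^sup>2 - a\<^sup>2)\<^sup>2"
  by algebra

lemma square_sum_le_triple_quartic:
  fixes a b c :: real
  shows "(a\<^sup>2 + b\<^sup>2 + c\<^sup>2)\<^sup>2 \<le> 3 * (a ^ 4 + b ^ 4 + c ^ 4)"
proof -
  have "0 \<le> (a\<^sup>2 - b\<^sup>2)\<^sup>2 + (b\<^sup>2 - c\<^sup>2)\<^sup>2 + (c\<^sup>2 - a\<^sup>2)\<^sup>2"
    by simp
  then show ?thesis
    using triple_quartic_sub_square_sum[of a b c] by linarith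
qed

lemma triple_quartic_eq_square_sum_iff:
  fixes a b c :: real
  assumes "0 \<le> a" "0 \<le> b" "0 \<le> c"
  shows "3 * (a ^ 4 + b ^ 4 + c ^ 4) = (a\<^sup>2 + b\<^sup>2 + c\<^sup>2)\<^sup>2 \<longleftrightarrow> a = b \<and> b = c"
proof
  assume "3 * (a ^ 4 + b ^ 4 + c ^ 4) = (a\<^sup>2 + b\<^sup>2 + c\<^sup>2)\<^sup>2"
  then have "(a\<^sup>2 - b\<^sup>2)\<^sup>2 + (b\<^sup>2 - c\<^sup>2)\<^sup>2 + (c\<^sup>2 - a\<^sup>2)\<^sup>2 = 0"
    using triple_quartic_sub_square_sum[of a b c] by linarith
  moreover have "0 \<le> (a\<^sup>2 - b\<^sup>2)\<^sup>2" "0 \<le> (b\<^sup>2 - c\<^sup>2)\<^sup>2" "0 \<le> (c\<^sup>2 - a\<^sup>2)\<^sup>2"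
    by (rule zero_le_power2)+
  ultimately have "(a\<^sup>2 - b\<^sup>2)\<^sup>2 = 0" "(b\<^sup>2 - c\<^sup>2)\<^sup>2 = 0"
    by linarith+
  then have "a\<^sup>2 = b\<^sup>2" "b\<^sup>2 = c\<^sup>2"
    by (simp_all only: power_eq_0_iff right_minus_eq)
  then show "a = b \<and> b = c"
    using assms by (metis power2_eq_imp_eq)
next
  assume "a = b \<and> b = c"
  then show "3 * (a ^ 4 + b ^ 4 + c ^ 4) = (a\<^sup>2 + b\<^sup>2 + c\<^sup>2)\<^sup>2"
    using triple_quartic_sub_square_sum[of a b c] by simp
qed

lemma side_triangle_inequalities:
  "side_c z \<le> side_a z + side_b z"
  "side_a z \<le> side_b z + side_c z"
  "side_b z \<le> side_c z + side_a z"
  unfolding side_a_def side_b_def side_c_def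
  by norm+

lemma side_nonneg: "0 \<le> side_a z" "0 \<le> side_b z" "0 \<le> side_c z"
  by (simp_all add: side_a_def side_b_def side_c_def)

text \<open>Reversing the roles of \<open>i\<close> and \<open>k\<close> gives the same condition, so only the middle
  vertex \<open>j\<close> matters.\<close>

lemma linear_triangle_iff_side_sum:
  "linear_triangle z \<longleftrightarrow>
    side_c z = side_a z + side_b z \<or>
    side_a z = side_b z + side_c z \<or>
    side_b z = side_c z + side_a z"
proof -
  have ex_3: "(\<exists>i. P i) \<longleftrightarrow> P 1 \<or> P 2 \<or> P 3" for P :: "3 \<Rightarrow> bool"
    by (metis exhaust_3)
  have distinct: "(1::3) \<noteq> 2" "(2::3) \<noteq> 1" "(1::3) \<noteq> 3" "(3::3) \<noteq> 1" "(2::3) \<noteq> 3" "(3::3) \<noteq> 2"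
    by simp_all
  have side: "norm (z $ 1 - z $ 2) = side_a z" "norm (z $ 2 - z $ 1) = side_a z"
    "norm (z $ 2 - z $ 3) = side_b z" "norm (z $ 3 - z $ 2) = side_b z"
    "norm (z $ 3 - z $ 1) = side_c z" "norm (z $ 1 - z $ 3) = side_c z"
    by (simp_all only: side_a_def side_b_def side_c_def norm_minus_commute)
  show ?thesis
    unfolding linear_triangle_def ex_3
    by (simp only: distinct side simp_thms) argo
qed

theorem theorem6:
  fixes z :: "complex ^ 3"
  assumes "plane_triangle z"
  shows "(1 / 3 \<le> quadrofactor z \<and> quadrofactor z \<le> 1 / 2) \<and>
         (quadrofactor z = 1 / 3 \<longleftrightarrow> regular z) \<and>
         (quadrofactor z = 1 / 2 \<longleftrightarrow> linear_triangle z)"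
proof -
  define a b c where abc: "a = side_a z" "b = side_b z" "c = side_c z"
  define Q where "Q = a ^ 4 + b ^ 4 + c ^ 4"
  define D where "D = (a\<^sup>2 + b\<^sup>2 + c\<^sup>2)\<^sup>2"
  have nonneg: "0 \<le> a" "0 \<le> b" "0 \<le> c"
    using side_nonneg by (simp_all add: abc)
  have nondegenerate: "a \<noteq> 0 \<or> b \<noteq> 0"
    using assms by (auto simp: plane_triangle_def singular_def abc side_a_def side_b_def)
  have "0 < a\<^sup>2 \<or> 0 < b\<^sup>2"
    using nondegenerate by simp
  then have "0 < a\<^sup>2 + b\<^sup>2 + c\<^sup>2"
    using zero_le_power2[of a] zero_le_power2[of b] zero_le_power2[of c] by linarith
  then have D_pos: "0 < D"
    by (simp add: D_def)
  have q: "quadrofactor z = Q / D"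
    by (simp add: quadrofactor_def Q_def D_def abc)
  have heron: "D - 2 * Q = (a + b + c) * (a + b - c) * (b + c - a) * (c + a - b)"
    unfolding D_def Q_def by (rule square_sum_sub_double_quartic_eq_heron)
  have perimeter_pos: "0 < a + b + c"
    using nonneg nondegenerate by linarith
  have slack: "0 \<le> a + b - c" "0 \<le> b + c - a" "0 \<le> c + a - b"
    using side_triangle_inequalities[of z] by (simp_all add: abc)
  have lower: "D \<le> 3 * Q"
    unfolding D_def Q_def by (rule square_sum_le_triple_quartic)
  have "0 \<le> D - 2 * Q"
    unfolding heron using perimeter_pos slack by simp
  then have upper: "2 * Q \<le> D"
    by simp
  have "3 * Q = D \<longleftrightarrow> a = b \<and> b = c"
    unfolding Q_def D_def using nonneg by (rule triple_quartic_eq_square_sum_iff)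
  then have regular_iff: "3 * Q = D \<longleftrightarrow> regular z"
    using assms by (simp add: regular_def equilateral_def plane_triangle_def abc)
  have "2 * Q = D \<longleftrightarrow> D - 2 * Q = 0"
    by auto
  also have "\<dots> \<longleftrightarrow> c = a + b \<or> a = b + c \<or> b = c + a"
    unfolding heron using perimeter_pos by auto
  finally have linear_iff: "2 * Q = D \<longleftrightarrow> linear_triangle z"
    by (simp add: linear_triangle_iff_side_sum abc)
  have "Q / D = 1 / 3 \<longleftrightarrow> 3 * Q = D" "Q / D = 1 / 2 \<longleftrightarrow> 2 * Q = D"
    using D_pos by (auto simp: field_simps)
  moreover have "1 / 3 \<le> Q / D" "Q / D \<le> 1 / 2"
    using D_pos lower upper by (simp_all add: field_simps)
  ultimately show ?thesis
    using q regular_iff linear_iff by simp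
qed

end
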